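(* Let $R$ be a nonvoid connected tight relation on $X\times Y$ that preserves both attribute and association privacy. Then $|X|=|Y|\geq 3$ and $R$ is isomorphic to either a cyclic staircase relation or a spherical boundary relation.
   Context: Everything is finite. A relation $R$ on $X\times Y$ is a subset of $X\times Y$; it is void if $X=\emptyset$ or $Y=\emptyset$. For $x\in X$, $Y_x=\{y\in Y:(x,y)\in R\}$ (a row); for $y\in Y$, $X_y=\{x\in X:(x,y)\in R\}$ (a column); a row or column is blank if it is empty. $R$ is tight if it has no blank rows or columns. $R$ is connected if it is connected as an undirected bipartite graph on the disjoint union of $X$ and $Y$ with edge set $R$. For $\sigma\subseteq X$, $\phi_R(\sigma)=\bigcap_{x\in\sigma}Y_x$ with $\phi_R(\emptyset)=Y$; for $\gamma\subseteq Y$, $\psi_R(\gamma)=\bigcap_{y\in\gamma}X_y$ with $\psi_R(\emptyset)=X$. For nonvoid $R$, $\Phi_R=\{\gamma\subseteq Y:\exists x\in X\ \forall y\in\gamma\ (x,y)\in R\}$ and $\Psi_R=\{\sigma\subseteq X:\exists y\in Y\ \forall x\in\sigma\ (x,y)\in R\}$ (both contain $\emptyset$). $R$ preserves attribute privacy if $(\phi_R\circ\psi_R)(\gamma)=\gamma$ for all $\gamma\in\Phi_R$ (including $\gamma=\emptyset$); $R$ preserves association privacy if $(\psi_R\circ\phi_R)(\sigma)=\sigma$ for all $\sigma\in\Psi_R$ (including $\sigma=\emptyset$). Two relations are isomorphic if there are bijections between their sets of individuals and between their sets of attributes carrying one relation onto the other. For $n\ge3$, a cyclic staircase relation is the relation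 on $\{x_1,\dots,x_n\}\times\{y_1,\dots,y_n\}$ given by $\{(x_i,y_i):1\le i\le n\}\cup\{(x_i,y_{i+1}):1\le i<n\}\cup\{(x_n,y_1)\}$ (up to isomorphism). For $n\ge 3$, a spherical boundary relation is the relation on $\{x_1,\dots,x_n\}\times\{y_1,\dots,y_n\}$ given by $\{(x_i,y_j): i\neq j\}$ (up to isomorphism). *)

theory Defs
  imports Main
begin

text \<open>A relation is given by its individuals \<open>X\<close>, its attributes \<open>Y\<close>, and the
  set \<open>R \<subseteq> X \<times> Y\<close>. All relations are finite.\<close>

definition relation_on :: "'a set \<Rightarrow> 'b set \<Rightarrow> ('a \<times> 'b) set \<Rightarrow> bool" where
  "relation_on X Y R \<longleftrightarrow> finite X \<and> finite Y \<and> R \<subseteq> X \<times> Y"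

definition void :: "'a set \<Rightarrow> 'b set \<Rightarrow> bool" where
  "void X Y \<longleftrightarrow> X = {} \<or> Y = {}"

definition row :: "'b set \<Rightarrow> ('a \<times> 'b) set \<Rightarrow> 'a \<Rightarrow> 'b set" where
  "row Y R x = {y \<in> Y. (x, y) \<in> R}"

definition col :: "'a set \<Rightarrow> ('a \<times> 'b) set \<Rightarrow> 'b \<Rightarrow> 'a set" where
  "col X R y = {x \<in> X. (x, y) \<in> R}"

definition tight :: "'a set \<Rightarrow> 'b set \<Rightarrow> ('a \<times> 'b) set \<Rightarrow> bool" where
  "tight X Y R \<longleftrightarrow> (\<forall>x\<in>X. row Y R x \<noteq> {}) \<and> (\<forall>y\<in>Y. col X R y \<noteq> {})"

text \<open>The undirected bipartite graph on the disjoint union of \<open>X\<close> and \<open>Y\<close>: each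
  edge is represented by its two orientations.\<close>

definition bip_edges :: "('a \<times> 'b) set \<Rightarrow> (('a + 'b) \<times> ('a + 'b)) set" where
  "bip_edges R = {(Inl x, Inr y) | x y. (x, y) \<in> R} \<union> {(Inr y, Inl x) | x y. (x, y) \<in> R}"

definition connected_rel :: "'a set \<Rightarrow> 'b set \<Rightarrow> ('a \<times> 'b) set \<Rightarrow> bool" where
  "connected_rel X Y R \<longleftrightarrow> (\<forall>u \<in> X <+> Y. \<forall>v \<in> X <+> Y. (u, v) \<in> (bip_edges R)\<^sup>*)"

text \<open>The outer intersection with \<open>Y\<close> (resp. \<open>X\<close>) gives the empty intersection its
  conventional value.\<close>

definition phi :: "'b set \<Rightarrow> ('a \<times> 'b) set \<Rightarrow> 'a set \<Rightarrow> 'b set" where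
  "phi Y R \<sigma> = Y \<inter> (\<Inter>x\<in>\<sigma>. row Y R x)"

definition psi :: "'a set \<Rightarrow> ('a \<times> 'b) set \<Rightarrow> 'b set \<Rightarrow> 'a set" where
  "psi X R \<gamma> = X \<inter> (\<Inter>y\<in>\<gamma>. col X R y)"

definition Phi :: "'a set \<Rightarrow> 'b set \<Rightarrow> ('a \<times> 'b) set \<Rightarrow> 'b set set" where
  "Phi X Y R = {\<gamma>. \<gamma> \<subseteq> Y \<and> (\<exists>x\<in>X. \<forall>y\<in>\<gamma>. (x, y) \<in> R)}"

definition Psi :: "'a set \<Rightarrow> 'b set \<Rightarrow> ('a \<times> 'b) set \<Rightarrow> 'a set set" where
  "Psi X Y R = {\<sigma>. \<sigma> \<subseteq> X \<and> (\<exists>y\<in>Y. \<forall>x\<in>\<sigma>. (x, y) \<in> R)}"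

definition preserves_attribute_privacy :: "'a set \<Rightarrow> 'b set \<Rightarrow> ('a \<times> 'b) set \<Rightarrow> bool" where
  "preserves_attribute_privacy X Y R \<longleftrightarrow> (\<forall>\<gamma> \<in> Phi X Y R. (phi Y R \<circ> psi X R) \<gamma> = \<gamma>)"

definition preserves_association_privacy :: "'a set \<Rightarrow> 'b set \<Rightarrow> ('a \<times> 'b) set \<Rightarrow> bool" where
  "preserves_association_privacy X Y R \<longleftrightarrow> (\<forall>\<sigma> \<in> Psi X Y R. (psi X R \<circ> phi Y R) \<sigma> = \<sigma>)"

definition isomorphic_rel ::
  "'a set \<Rightarrow> 'b set \<Rightarrow> ('a \<times> 'b) set \<Rightarrow> 'c set \<Rightarrow> 'd set \<Rightarrow> ('c \<times> 'd) set \<Rightarrow> bool" where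
  "isomorphic_rel X Y R X' Y' R' \<longleftrightarrow>
     (\<exists>f g. bij_betw f X X' \<and> bij_betw g Y Y' \<and> map_prod f g ` R = R')"

definition cyclic_staircase :: "nat \<Rightarrow> (nat \<times> nat) set" where
  "cyclic_staircase n =
     {(i, i) | i. 1 \<le> i \<and> i \<le> n} \<union> {(i, i + 1) | i. 1 \<le> i \<and> i < n} \<union> {(n, 1)}"

definition spherical_boundary :: "nat \<Rightarrow> (nat \<times> nat) set" where
  "spherical_boundary n = {(i, j). i \<in> {1..n} \<and> j \<in> {1..n} \<and> i \<noteq> j}"

definition is_cyclic_staircase :: "'a set \<Rightarrow> 'b set \<Rightarrow> ('a \<times> 'b) set \<Rightarrow> bool" where
  "is_cyclic_staircase X Y R \<longleftrightarrow>
     (\<exists>n\<ge>3. isomorphic_rel X Y R {1..n} {1..n} (cyclic_staircase n))"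

definition is_spherical_boundary :: "'a set \<Rightarrow> 'b set \<Rightarrow> ('a \<times> 'b) set \<Rightarrow> bool" where
  "is_spherical_boundary X Y R \<longleftrightarrow>
     (\<exists>n\<ge>3. isomorphic_rel X Y R {1..n} {1..n} (spherical_boundary n))"

end

theory Submission
  imports Defs
begin

text \<open>Deleting one attribute \<open>y\<close> from the row of \<open>x\<close> and applying attribute privacy gives
  an individual \<open>w y\<close> that has all attributes of \<open>x\<close> except \<open>y\<close>. These individuals are
  distinct, and all but \<open>w y\<close> lie in the column of \<open>y\<close>, as does \<open>x\<close>; so this column is at least
  as large as the row of \<open>x\<close>. Dually the row is at least as large as the column, and by
  connectedness all rows and columns have the same size \<open>k\<close>. Equality also means that the column
  of \<open>y\<close> consists of \<open>x\<close> and the \<open>w y'\<close> with \<open>y' \<noteq> y\<close> only, so that two rows that meet differ in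
  a single attribute. If \<open>k = 1\<close>, the relation is a single pair, which is not private. If
  \<open>k = 2\<close>, the bipartite graph is a cycle. If \<open>k \<ge> 3\<close>, the rows of the \<open>w y\<close> meet pairwise,
  whence their attributes outside the row of \<open>x\<close> all coincide with one attribute \<open>z\<close>; then \<open>x\<close>
  and the \<open>w y\<close> form, with the row of \<open>x\<close> and \<open>z\<close>, a connected component.\<close>

section \<open>Isomorphisms, and duality under the converse relation\<close>

text \<open>The maps built below go from a numbered model onto \<open>X\<close> and
  \<open>Y\<close>; this turns them around. The containment of \<open>R'\<close> makes the inverses
  undo \<open>f\<close> and \<open>g\<close> on each of its pairs.\<close>

lemma isomorphic_rel_sym:
  assumes "isomorphic_rel X' Y' R' X Y R" and "R' \<subseteq> X' \<times> Y'"
  shows "isomorphic_rel X Y R X' Y' R'"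
proof -
  from assms(1) obtain f g where f: "bij_betw f X' X" and g: "bij_betw g Y' Y"
    and R: "map_prod f g ` R' = R"
    unfolding isomorphic_rel_def by blast
  let ?f = "inv_into X' f" and ?g = "inv_into Y' g"
  have "map_prod ?f ?g (map_prod f g e) = e" if "e \<in> R'" for e
    using that assms(2) f g by (auto simp: bij_betw_def)
  then have "map_prod ?f ?g ` R = R'"
    unfolding R[symmetric] image_image by simp
  then show ?thesis
    unfolding isomorphic_rel_def using bij_betw_inv_into[OF f] bij_betw_inv_into[OF g] by blast
qed

lemma phi_converse: "phi X (R\<inverse>) = psi X R"
  and psi_converse: "psi Y (R\<inverse>) = phi Y R"
  by (simp_all add: fun_eq_iff phi_def psi_def row_def col_def)

lemma Phi_converse: "Phi Y X (R\<inverse>) = Psi X Y R"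
  by (simp add: Phi_def Psi_def)

text \<open>Carries consequences of attribute privacy for rows over to columns under association
  privacy.\<close>

lemma preserves_attribute_privacy_converse:
  "preserves_attribute_privacy Y X (R\<inverse>) = preserves_association_privacy X Y R"
  by (simp add: preserves_attribute_privacy_def preserves_association_privacy_def
      phi_converse psi_converse Phi_converse)

section \<open>Deleting one attribute from a row\<close>

text \<open>The shortened row lies in \<open>Phi\<close>, as \<open>x\<close> itself has it, so
  privacy keeps \<open>y\<close> out of its closure: some individual with the whole shortened row
  lacks \<open>y\<close>. For a one-element row this is privacy of the empty set.\<close>

lemma attribute_privacy_delete:
  assumes "R \<subseteq> X \<times> Y" and "preserves_attribute_privacy X Y R" and "(x, y) \<in> R"
  shows "\<exists>x'\<in>X. R `` {x} - R `` {x'} = {y}"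
proof -
  let ?\<gamma> = "R `` {x} - {y}"
  have "?\<gamma> \<in> Phi X Y R"
    using assms(1,3) unfolding Phi_def by blast
  then have "phi Y R (psi X R ?\<gamma>) = ?\<gamma>"
    using assms(2) by (simp add: preserves_attribute_privacy_def)
  then have "y \<notin> phi Y R (psi X R ?\<gamma>)"
    by blast
  then obtain x' where "x' \<in> psi X R ?\<gamma>" "(x', y) \<notin> R"
    using assms(1,3) by (auto simp: phi_def row_def)
  then have "x' \<in> X" "R `` {x} - R `` {x'} = {y}"
    using assms(3) by (auto simp: psi_def col_def)
  then show ?thesis by blast
qed

text \<open>The cardinality is stated for the witnesses together with \<open>x\<close>, not for the
  column, so that both the inequality of sizes and its equality case can be read off.\<close>

lemma delete_witnesses:
  assumes fin: "finite R"
    and del: "\<And>y. (x, y) \<in> R \<Longrightarrow> \<exists>x'\<in>X. R `` {x} - R `` {x'} = {y}"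
  shows "\<exists>w. inj_on w (R `` {x}) \<and> (\<forall>y\<in>R `` {x}. w y \<in> X \<and>
    R `` {x} - R `` {w y} = {y} \<and> w y \<noteq> x \<and>
    insert x (w ` (R `` {x} - {y})) \<subseteq> R\<inverse> `` {y} \<and>
    card (insert x (w ` (R `` {x} - {y}))) = card (R `` {x}))"
proof -
  have "\<exists>w. \<forall>y\<in>R `` {x}. w y \<in> X \<and> R `` {x} - R `` {w y} = {y}"
    by (rule bchoice) (use del in \<open>simp add: Bex_def\<close>)
  then obtain w where w: "\<forall>y\<in>R `` {x}. w y \<in> X \<and> R `` {x} - R `` {w y} = {y}" ..
  have wX: "w y \<in> X" and wd: "R `` {x} - R `` {w y} = {y}" if "y \<in> R `` {x}" for y
    using w that by auto
  have ne: "w y \<noteq> x" if "y \<in> R `` {x}" for y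
    using wd[OF that] by auto
  have inj: "inj_on w (R `` {x})"
  proof (rule inj_onI)
    fix y y' assume y: "y \<in> R `` {x}" and y': "y' \<in> R `` {x}" and eq: "w y = w y'"
    show "y = y'"
      using wd[OF y] wd[OF y'] unfolding eq by (metis singleton_inject)
  qed
  have sub: "insert x (w ` (R `` {x} - {y})) \<subseteq> R\<inverse> `` {y}" if y: "y \<in> R `` {x}" for y
  proof -
    have "(w y', y) \<in> R" if "y' \<in> R `` {x}" "y' \<noteq> y" for y'
      using wd[OF that(1)] that(2) y by (metis DiffI Image_singleton_iff singletonD)
    then show ?thesis using y by auto
  qed
  have card: "card (insert x (w ` (R `` {x} - {y}))) = card (R `` {x})"
    if y: "y \<in> R `` {x}" for y
  proof -
    have finx: "finite (R `` {x})" using fin by (simp add: finite_Image)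
    have "card (w ` (R `` {x} - {y})) = card (R `` {x} - {y})"
      by (rule card_image) (rule inj_on_subset[OF inj], blast)
    moreover have "x \<notin> w ` (R `` {x} - {y})" using ne by blast
    moreover have "card (R `` {x}) = Suc (card (R `` {x} - {y}))"
      using card.remove[OF finx y] .
    ultimately show ?thesis using finx by simp
  qed
  show ?thesis
    by (intro exI[of _ w] conjI ballI inj wX wd ne sub card)
qed

text \<open>Assumes deletion instead of privacy, and so applies directly to the converse as
  well.\<close>

lemma card_row_le_card_col:
  assumes "finite R" and "(x, y) \<in> R"
    and "\<And>y. (x, y) \<in> R \<Longrightarrow> \<exists>x'\<in>X. R `` {x} - R `` {x'} = {y}"
  shows "card (R `` {x}) \<le> card (R\<inverse> `` {y})"
proof -
  obtain w where "\<forall>y\<in>R `` {x}. insert x (w ` (R `` {x} - {y})) \<subseteq> R\<inverse> `` {y} \<and>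
      card (insert x (w ` (R `` {x} - {y}))) = card (R `` {x})"
    using delete_witnesses[OF assms(1,3)] by metis
  then have "insert x (w ` (R `` {x} - {y})) \<subseteq> R\<inverse> `` {y}"
    and card: "card (insert x (w ` (R `` {x} - {y}))) = card (R `` {x})"
    using assms(2) by (blast, blast)
  from card_mono[OF _ this(1)] assms(1) show ?thesis
    unfolding card by (simp add: finite_Image)
qed

section \<open>Unions of connected components\<close>

text \<open>No edge leaves \<open>A <+> B\<close>, so paths from \<open>x\<close> stay inside. This
  serves both to spread a constant degree and to show that a piece already found is the whole
  relation.\<close>

lemma connected_rel_closed:
  assumes conn: "connected_rel X Y R"
    and iff: "\<And>x y. (x, y) \<in> R \<Longrightarrow> x \<in> A \<longleftrightarrow> y \<in> B"
    and x: "x \<in> X" "x \<in> A"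
  shows "X \<subseteq> A" and "Y \<subseteq> B"
proof -
  have "v \<in> A <+> B" if "(u, v) \<in> (bip_edges R)\<^sup>*" "u \<in> A <+> B" for u v
    using that
  proof (induction rule: rtrancl_induct)
    case (step v v')
    then show ?case using iff by (auto simp: bip_edges_def)
  qed
  then have *: "v \<in> A <+> B" if "v \<in> X <+> Y" for v
    using conn x that unfolding connected_rel_def by blast
  show "X \<subseteq> A" using * by blast
  show "Y \<subseteq> B" using * by blast
qed

section \<open>Relations with constant row and column size\<close>

locale private_regular =
  fixes X :: "'a set" and Y :: "'b set" and R :: "('a \<times> 'b) set" and k :: nat
  assumes finite_R: "finite R"
    and sub: "R \<subseteq> X \<times> Y"
    and conn: "connected_rel X Y R"
    and card_row: "x \<in> X \<Longrightarrow> card (R `` {x}) = k"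
    and card_col: "y \<in> Y \<Longrightarrow> card (R\<inverse> `` {y}) = k"
    and delete: "(x, y) \<in> R \<Longrightarrow> \<exists>x'\<in>X. R `` {x} - R `` {x'} = {y}"
begin

lemma finite_row: "finite (R `` {x})" and finite_col: "finite (R\<inverse> `` {y})"
  using finite_R by (simp_all add: finite_Image)

text \<open>The column of \<open>y\<close> has size \<open>k\<close>, as has its subset from
  \<open>delete_witnesses\<close>, so the two coincide.\<close>

lemma witnesses:
  "\<exists>w. inj_on w (R `` {x}) \<and> (\<forall>y\<in>R `` {x}. w y \<in> X \<and>
    R `` {x} - R `` {w y} = {y} \<and> w y \<noteq> x \<and>
    R\<inverse> `` {y} = insert x (w ` (R `` {x} - {y})))"
proof -
  obtain w where inj: "inj_on w (R `` {x})"
    and w: "\<forall>y\<in>R `` {x}. w y \<in> X \<and> R `` {x} - R `` {w y} = {y} \<and> w y \<noteq> x \<and>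
      insert x (w ` (R `` {x} - {y})) \<subseteq> R\<inverse> `` {y} \<and>
      card (insert x (w ` (R `` {x} - {y}))) = card (R `` {x})"
    using delete_witnesses[OF finite_R delete] by metis
  have "R\<inverse> `` {y} = insert x (w ` (R `` {x} - {y}))" if y: "y \<in> R `` {x}" for y
  proof -
    have "x \<in> X" "y \<in> Y" using y sub by auto
    then have "card (insert x (w ` (R `` {x} - {y}))) = card (R\<inverse> `` {y})"
      using bspec[OF w y] card_row card_col by metis
    then show ?thesis
      using card_subset_eq[OF finite_col] bspec[OF w y] by metis
  qed
  then show ?thesis using inj w by (intro exI[of _ w]) simp
qed

text \<open>The column of \<open>y\<close> consists of \<open>x\<close> and witnesses only, so
  \<open>x'\<close> is the witness for some attribute of \<open>x\<close>, and this attribute is the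
  difference.\<close>

lemma row_diff_singleton:
  assumes "(x, y) \<in> R" "(x', y) \<in> R" "x \<noteq> x'"
  shows "\<exists>a. R `` {x} - R `` {x'} = {a}"
proof -
  obtain w where w: "\<forall>y\<in>R `` {x}. R `` {x} - R `` {w y} = {y} \<and>
      R\<inverse> `` {y} = insert x (w ` (R `` {x} - {y}))"
    using witnesses[of x] by meson
  then have "x' \<in> insert x (w ` (R `` {x} - {y}))"
    using assms(1,2) by blast
  then obtain y' where "y' \<in> R `` {x}" "x' = w y'" using assms(3) by blast
  with w show ?thesis by blast
qed

section \<open>Row size at least three: spherical boundary relations\<close>

lemma spherical:
  assumes "X \<noteq> {}" and k: "k \<ge> 3"
  shows "is_spherical_boundary X Y R"
proof -
  obtain x0 where x0: "x0 \<in> X" using assms(1) by blast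
  define Y0 where "Y0 = R `` {x0}"
  have cY0: "card Y0 = k" and fY0: "finite Y0"
    using card_row[OF x0] finite_row by (simp_all add: Y0_def)
  obtain w where inj: "inj_on w Y0" and "\<forall>y\<in>Y0. w y \<in> X \<and>
      Y0 - R `` {w y} = {y} \<and> w y \<noteq> x0 \<and> R\<inverse> `` {y} = insert x0 (w ` (Y0 - {y}))"
    using witnesses[of x0] unfolding Y0_def by blast
  then have w: "w y \<in> X" "Y0 - R `` {w y} = {y}" "w y \<noteq> x0"
    "R\<inverse> `` {y} = insert x0 (w ` (Y0 - {y}))" if "y \<in> Y0" for y
    using that by (blast, blast, blast, blast)
  have mem: "(w y, y') \<in> R \<longleftrightarrow> y' \<noteq> y" if "y \<in> Y0" "y' \<in> Y0" for y y'
    using w(2)[OF that(1)] that by blast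
  \<comment> \<open>Here \<open>k \<ge> 3\<close> enters: for \<open>a\<close> and \<open>b\<close>
    in \<open>Y0\<close>, the attribute \<open>c\<close> is common to the rows of \<open>x0\<close>,
    \<open>w a\<close> and \<open>w b\<close>, so \<open>row_diff_singleton\<close> applies to any
    two of these that are distinct.\<close>
  have third: "\<exists>c\<in>Y0. c \<noteq> a \<and> c \<noteq> b" for a b
  proof (rule ccontr)
    assume "\<not> ?thesis"
    then have "Y0 \<subseteq> {a, b}" by blast
    then have "card Y0 \<le> card {a, b}" by (simp add: card_mono)
    also have "\<dots> \<le> 2" by (simp add: card_insert_if)
    finally show False using cY0 k by simp
  qed
  have ex: "\<exists>z. R `` {w y} - Y0 = {z}" if "y \<in> Y0" for y
  proof -
    obtain c where c: "c \<in> Y0" "c \<noteq> y" using third by blast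
    show ?thesis
      unfolding Y0_def
    proof (rule row_diff_singleton)
      show "(w y, c) \<in> R" using mem that c by blast
      show "(x0, c) \<in> R" using c by (simp add: Y0_def)
      show "w y \<noteq> x0" by (rule w(3)[OF that])
    qed
  qed
  \<comment> \<open>For \<open>y \<noteq> y'\<close>, the single attribute that \<open>w y\<close>
    has and \<open>w y'\<close> lacks is \<open>y'\<close>, which lies in \<open>Y0\<close>;
    everything outside \<open>Y0\<close> is therefore passed on.\<close>
  have same: "R `` {w y} - Y0 \<subseteq> R `` {w y'} - Y0" if y: "y \<in> Y0" and y': "y' \<in> Y0" for y y'
  proof (cases "y = y'")
    case False
    obtain c where c: "c \<in> Y0" "c \<noteq> y" "c \<noteq> y'" using third by blast
    have "\<exists>a. R `` {w y} - R `` {w y'} = {a}"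
    proof (rule row_diff_singleton)
      show "(w y, c) \<in> R" "(w y', c) \<in> R" using mem y y' c by blast+
      show "w y \<noteq> w y'" using False y y' inj by (auto simp: inj_on_def)
    qed
    moreover have "y' \<in> R `` {w y} - R `` {w y'}" using mem y y' False by blast
    ultimately have "R `` {w y} - R `` {w y'} = {y'}" by force
    moreover have "a \<in> R `` {w y'}" if "a \<in> R `` {w y}" "a \<noteq> y'" for a
      using that calculation by blast
    ultimately show ?thesis using y' by blast
  qed simp
  obtain y0 where y0: "y0 \<in> Y0" using third by blast
  then obtain z where z: "R `` {w y0} - Y0 = {z}" using ex by blast
  have out: "R `` {w y} - Y0 = {z}" if "y \<in> Y0" for y
    using same[OF that y0] same[OF y0 that] z by blast
  have zY0: "z \<notin> Y0" using z by blast
  have row_w: "R `` {w y} = insert z Y0 - {y}" if "y \<in> Y0" for y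
    using out[OF that] w(2)[OF that] zY0 by blast
  have zY: "z \<in> Y" using row_w[OF y0] zY0 y0 sub by blast
  \<comment> \<open>The \<open>k\<close> distinct witnesses all have \<open>z\<close> and so exhaust
    its column.\<close>
  have col_z: "R\<inverse> `` {z} = w ` Y0"
  proof -
    have "w ` Y0 \<subseteq> R\<inverse> `` {z}" using row_w zY0 by blast
    moreover have "card (w ` Y0) = card (R\<inverse> `` {z})"
      using card_image[OF inj] cY0 card_col[OF zY] by simp
    ultimately show ?thesis using card_subset_eq[OF finite_col] by blast
  qed
  have closed: "x \<in> insert x0 (w ` Y0) \<longleftrightarrow> y \<in> insert z Y0" if xy: "(x, y) \<in> R" for x y
  proof
    assume "x \<in> insert x0 (w ` Y0)"
    then show "y \<in> insert z Y0" using xy row_w by (auto simp: Y0_def)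
  next
    assume "y \<in> insert z Y0"
    then show "x \<in> insert x0 (w ` Y0)" using xy col_z w(4) by blast
  qed
  have "X \<subseteq> insert x0 (w ` Y0)" "Y \<subseteq> insert z Y0"
    using connected_rel_closed[OF conn closed x0] by auto
  then have X: "X = insert x0 (w ` Y0)" and Y: "Y = insert z Y0"
    using x0 zY w(1) sub by (auto simp: Y0_def)
  \<comment> \<open>\<open>h\<close> sends each attribute to the individual that lacks just this
    one; \<open>z\<close> is what \<open>x0\<close> lacks.\<close>
  define h where "h = w(z := x0)"
  have hw: "h y = w y" if "y \<in> Y0" for y using that zY0 by (auto simp: h_def)
  have hz: "h z = x0" by (simp add: h_def)
  have row_h: "R `` {h y} = Y - {y}" if "y \<in> Y" for y
  proof (cases "y = z")
    case True
    then show ?thesis using hz zY0 by (auto simp: Y Y0_def)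
  next
    case False
    then have "y \<in> Y0" using that Y by simp
    then show ?thesis using row_w hw Y by simp
  qed
  have bij_h: "bij_betw h Y X"
  proof (rule bij_betw_imageI)
    show "inj_on h Y"
    proof (rule inj_onI)
      fix a b assume "a \<in> Y" "b \<in> Y" "h a = h b"
      then have "Y - {a} = Y - {b}" using row_h by metis
      then show "a = b" using \<open>a \<in> Y\<close> \<open>b \<in> Y\<close> by blast
    qed
    show "h ` Y = X" using hw hz by (auto simp: X Y)
  qed
  have fY: "finite Y" using fY0 Y by simp
  have cY: "card Y = Suc k" using fY0 zY0 cY0 Y by simp
  obtain g where g: "bij_betw g {1..card Y} Y"
    using ex_bij_betw_nat_finite_1[OF fY] by blast
  have gimg: "g ` {1..card Y} = Y" and ginj: "inj_on g {1..card Y}"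
    using g by (auto simp: bij_betw_def)
  have "map_prod (h \<circ> g) g ` spherical_boundary (card Y) = R"
  proof (rule set_eqI, rule iffI)
    fix e assume "e \<in> map_prod (h \<circ> g) g ` spherical_boundary (card Y)"
    then obtain i j where ij: "i \<in> {1..card Y}" "j \<in> {1..card Y}" "i \<noteq> j"
      and e: "e = (h (g i), g j)"
      unfolding spherical_boundary_def by auto
    have "g i \<in> Y" "g j \<in> Y" "g i \<noteq> g j"
      using ij gimg ginj by (auto dest: inj_onD)
    then have "g j \<in> R `` {h (g i)}" using row_h by simp
    then show "e \<in> R" using e by simp
  next
    fix e assume "e \<in> R"
    then obtain x y where e: "e = (x, y)" "(x, y) \<in> R" "x \<in> X" "y \<in> Y" using sub by blast
    then obtain y' where y': "y' \<in> Y" "x = h y'" using bij_h by (auto simp: bij_betw_def)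
    then have "y \<in> Y - {y'}" using e row_h by auto
    then have "y \<noteq> y'" by simp
    obtain i j where ij: "i \<in> {1..card Y}" "j \<in> {1..card Y}" "g i = y'" "g j = y"
      using y' e gimg by (metis imageE)
    then have "(i, j) \<in> spherical_boundary (card Y)"
      using \<open>y \<noteq> y'\<close> by (auto simp: spherical_boundary_def)
    moreover have "map_prod (h \<circ> g) g (i, j) = e" using ij y' e by simp
    ultimately show "e \<in> map_prod (h \<circ> g) g ` spherical_boundary (card Y)" by blast
  qed
  then have "isomorphic_rel {1..card Y} {1..card Y} (spherical_boundary (card Y)) X Y R"
    unfolding isomorphic_rel_def using bij_betw_trans[OF g bij_h] g by blast
  then have "isomorphic_rel X Y R {1..card Y} {1..card Y} (spherical_boundary (card Y))"
    by (rule isomorphic_rel_sym) (auto simp: spherical_boundary_def)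
  then show ?thesis
    unfolding is_spherical_boundary_def using cY k by (metis le_SucI)
qed

section \<open>Row size two: cyclic staircases\<close>

lemma staircase:
  assumes "X \<noteq> {}" and k: "k = 2"
  shows "is_cyclic_staircase X Y R"
proof -
  have row2: "R `` {x} = {a, b}" if "(x, a) \<in> R" "(x, b) \<in> R" "a \<noteq> b" for x a b
  proof -
    have "card (R `` {x}) = card {a, b}" using that card_row[of x] sub k by auto
    moreover have "{a, b} \<subseteq> R `` {x}" using that by simp
    ultimately show ?thesis using card_subset_eq[OF finite_row] by metis
  qed
  have col2: "R\<inverse> `` {y} = {a, b}" if "(a, y) \<in> R" "(b, y) \<in> R" "a \<noteq> b" for y a b
  proof -
    have "card (R\<inverse> `` {y}) = card {a, b}" using that card_col[of y] sub k by auto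
    moreover have "{a, b} \<subseteq> R\<inverse> `` {y}" using that by simp
    ultimately show ?thesis using card_subset_eq[OF finite_col] by metis
  qed
  have other_row: "\<exists>b. (x, b) \<in> R \<and> b \<noteq> a" if "(x, a) \<in> R" for x a
  proof (rule ccontr)
    assume "\<not> ?thesis"
    with that have "R `` {x} = {a}" by blast
    moreover have "x \<in> X" using that sub by blast
    ultimately show False using card_row k by force
  qed
  have other_col: "\<exists>b. (b, y) \<in> R \<and> b \<noteq> a" if "(a, y) \<in> R" for y a
  proof (rule ccontr)
    assume "\<not> ?thesis"
    with that have "R\<inverse> `` {y} = {a}" by blast
    moreover have "y \<in> Y" using that sub by blast
    ultimately show False using card_col k by force
  qed
  obtain x0 where "x0 \<in> X" using assms(1) by blast
  then have "R `` {x0} \<noteq> {}" using card_row k by force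
  then obtain y0 where "(x0, y0) \<in> R" by blast
  then have "\<exists>e. e \<in> R" by blast
  \<comment> \<open>One move along the graph: from an edge to the other attribute of its individual,
    then to the other individual of that attribute. Dependent choice iterates this to an infinite
    walk without backtracking.\<close>
  moreover have "\<exists>e'. e' \<in> R \<and> ((fst e, snd e') \<in> R \<and> snd e' \<noteq> snd e \<and> fst e' \<noteq> fst e)"
    if "e \<in> R" for e
    using other_row[of "fst e" "snd e"] other_col[of "fst e"] that by fastforce
  ultimately obtain e where e: "\<And>i. e i \<in> R \<and> ((fst (e i), snd (e (Suc i))) \<in> R \<and>
      snd (e (Suc i)) \<noteq> snd (e i) \<and> fst (e (Suc i)) \<noteq> fst (e i))"
    using dependent_nat_choice[of "\<lambda>_ e. e \<in> R"
      "\<lambda>_ e e'. (fst e, snd e') \<in> R \<and> snd e' \<noteq> snd e \<and> fst e' \<noteq> fst e"] by auto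
  define x where "x i = fst (e i)" for i
  define y where "y i = snd (e i)" for i
  have diag: "(x i, y i) \<in> R" and step: "(x i, y (Suc i)) \<in> R"
    and yne: "y (Suc i) \<noteq> y i" and xne: "x (Suc i) \<noteq> x i" for i
    using e[of i] by (simp_all add: x_def y_def)
  have row: "R `` {x i} = {y i, y (Suc i)}" for i
    using row2[OF diag step] yne by metis
  have col: "R\<inverse> `` {y (Suc i)} = {x i, x (Suc i)}" for i
    using col2[OF step diag] xne by metis
  have finX: "finite (range x)"
    by (rule finite_subset[of _ "fst ` R"]) (use diag finite_R in \<open>force+\<close>)
  then have "\<not> inj x" using finite_imageD infinite_UNIV_nat by blast
  then obtain i j where "x i = x j" "i \<noteq> j" by (auto simp: inj_def)
  then have rep: "\<exists>n. \<exists>i<n. x n = x i" by (metis nat_neq_iff)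
  \<comment> \<open>The first return of the walk to an earlier individual; minimality makes
    \<open>x\<close> injective below \<open>n\<close>.\<close>
  define n where "n = (LEAST n. \<exists>i<n. x n = x i)"
  obtain i0 where i0: "i0 < n" "x n = x i0"
    using LeastI_ex[OF rep] unfolding n_def by blast
  have "x i \<noteq> x j" if "i < j" "j < n" for i j
    using not_less_Least[of j "\<lambda>n. \<exists>i<n. x n = x i"] that by (metis n_def)
  then have xinj: "inj_on x {..<n}"
    by (intro linorder_inj_onI) auto
  obtain m where m: "n = Suc m" using i0 by (cases n) auto
  have yn: "(x i0, y n) \<in> R" using diag[of n] i0 by simp
  \<comment> \<open>The column of \<open>y (Suc i)\<close> is already filled by \<open>x i\<close>
    and \<open>x (Suc i)\<close>, while \<open>x m\<close> has \<open>y n\<close>. This forces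
    \<open>m = Suc i\<close>, and then the walk would repeat an attribute at once.\<close>
  have no: "y n \<noteq> y (Suc i)" if "i < m" for i
  proof
    assume eq: "y n = y (Suc i)"
    have "x m \<in> {x i, x (Suc i)}" using eq step[of m] col[of i] m by auto
    then have "m = Suc i"
      using that xinj m by (auto dest: inj_onD)
    then show False using eq yne[of m] m by simp
  qed
  have "y n = y i0 \<or> y n = y (Suc i0)" using row[of i0] yn by blast
  moreover have "i0 \<noteq> m" using i0 xne[of m] m by auto
  then have "i0 < m" using i0 m by simp
  ultimately have yi0: "y n = y i0" using no by blast
  \<comment> \<open>The walk closes up at its start: for positive \<open>i0\<close>, the attribute
    \<open>y i0 = y n\<close> would be one of those excluded by \<open>no\<close>.\<close>
  have "i0 = 0"
  proof (cases i0)
    case (Suc i)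
    then show ?thesis using no[of i] \<open>i0 < m\<close> yi0 by simp
  qed
  then have x_n: "x n = x 0" and y_n: "y n = y 0" and "m > 0"
    using i0 yi0 \<open>i0 < m\<close> by simp_all
  \<comment> \<open>A cycle through two individuals only would give them equal rows, although rows
    that meet differ.\<close>
  have "m \<noteq> 1"
  proof
    assume "m = 1"
    then have "R `` {x 0} - R `` {x (Suc 0)} = {}"
      using row[of 0] row[of "Suc 0"] m y_n by auto
    moreover have "\<exists>a. R `` {x 0} - R `` {x (Suc 0)} = {a}"
      by (rule row_diff_singleton[OF step[of 0] diag]) (use xne[of 0] in simp)
    ultimately show False by (metis insert_not_empty)
  qed
  then have n3: "n \<ge> 3" using m \<open>m > 0\<close> by simp
  have "y i \<noteq> y j" if ij: "i < j" "j < n" for i j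
  proof
    assume eq: "y i = y j"
    obtain l where l: "j = Suc l" using ij by (cases j) auto
    have "x i \<in> {x l, x j}" using col[of l] diag[of i] eq l by auto
    then have "i = l" using xinj ij l by (auto dest: inj_onD)
    then show False using eq yne[of l] l by simp
  qed
  then have yinj: "inj_on y {..<n}"
    by (intro linorder_inj_onI) auto
  have wrap: "y (Suc i) \<in> y ` {..<n}" if "i < n" for i
    using that y_n by (cases "Suc i = n") auto
  have closed: "a \<in> x ` {..<n} \<longleftrightarrow> b \<in> y ` {..<n}" if ab: "(a, b) \<in> R" for a b
  proof
    assume "a \<in> x ` {..<n}"
    then obtain i where "i < n" "a = x i" by blast
    then show "b \<in> y ` {..<n}" using row[of i] ab wrap[of i] by auto
  next
    assume "b \<in> y ` {..<n}"
    then obtain i where i: "i < n" "b = y i" by blast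
    show "a \<in> x ` {..<n}"
    proof (cases i)
      \<comment> \<open>The column of \<open>y 0\<close> is read off as that of
        \<open>y (Suc m)\<close>, since \<open>col\<close> speaks of successors only.\<close>
      case 0
      then have "a \<in> {x m, x 0}" using i ab col[of m] x_n y_n m by auto
      then show ?thesis using m by auto
    next
      case (Suc l)
      then have "a \<in> {x l, x i}" using i ab col[of l] by auto
      then show ?thesis using i Suc by auto
    qed
  qed
  have x0: "x 0 \<in> X" "x 0 \<in> x ` {..<n}" using diag[of 0] sub n3 by auto
  have "X \<subseteq> x ` {..<n}" "Y \<subseteq> y ` {..<n}"
    using connected_rel_closed[OF conn closed x0] by auto
  then have X: "x ` {..<n} = X" and Y: "y ` {..<n} = Y"
    using diag sub by fastforce+
  \<comment> \<open>The walk is numbered from 0, the model from 1.\<close>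
  define p where "p i = x (i - 1)" for i
  define q where "q i = y (i - 1)" for i
  have shift: "bij_betw (\<lambda>i. i - 1) {1..n} {..<n}"
    by (rule bij_betw_byWitness[of _ Suc]) auto
  have bp: "bij_betw p {1..n} X"
    using bij_betw_trans[OF shift bij_betw_imageI[OF xinj X]] by (simp add: p_def[abs_def] comp_def)
  have bq: "bij_betw q {1..n} Y"
    using bij_betw_trans[OF shift bij_betw_imageI[OF yinj Y]] by (simp add: q_def[abs_def] comp_def)
  have "map_prod p q ` cyclic_staircase n = R"
  proof (rule set_eqI, rule iffI)
    fix u assume "u \<in> map_prod p q ` cyclic_staircase n"
    then consider i where "u = (x (i - 1), y (i - 1))"
      | i where "1 \<le> i" "u = (x (i - 1), y i)"
      | "u = (x (n - 1), y 0)"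
      unfolding cyclic_staircase_def p_def q_def by auto
    then show "u \<in> R"
    proof cases
      case (2 i)
      then show ?thesis using step[of "i - 1"] by simp
    next
      case 3
      then show ?thesis using step[of m] m y_n by simp
    qed (simp add: diag)
  next
    fix u assume u: "u \<in> R"
    then have "fst u \<in> X" using sub by auto
    then obtain i where i: "i < n" "fst u = x i" using X by auto
    then have "snd u \<in> R `` {x i}" using u by (metis Image_singleton_iff prod.collapse)
    then consider "u = map_prod p q (Suc i, Suc i)" | "u = (x i, y (Suc i))"
      using row[of i] i by (auto simp: p_def q_def prod_eq_iff)
    then show "u \<in> map_prod p q ` cyclic_staircase n"
    proof cases
      case 1
      have "(Suc i, Suc i) \<in> cyclic_staircase n" using i by (auto simp: cyclic_staircase_def)
      then show ?thesis using 1 by blast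
    next
      case 2
      show ?thesis
      proof (cases "Suc i = n")
        case True
        then have "u = map_prod p q (n, 1)" using 2 y_n by (auto simp: p_def q_def)
        moreover have "(n, 1) \<in> cyclic_staircase n" by (simp add: cyclic_staircase_def)
        ultimately show ?thesis by blast
      next
        case False
        then have "(Suc i, Suc i + 1) \<in> cyclic_staircase n"
          using i by (auto simp: cyclic_staircase_def)
        moreover have "u = map_prod p q (Suc i, Suc i + 1)"
          using 2 by (simp add: p_def q_def)
        ultimately show ?thesis by blast
      qed
    qed
  qed
  then have "isomorphic_rel {1..n} {1..n} (cyclic_staircase n) X Y R"
    unfolding isomorphic_rel_def using bp bq by blast
  then have "isomorphic_rel X Y R {1..n} {1..n} (cyclic_staircase n)"
    by (rule isomorphic_rel_sym) (use n3 in \<open>auto simp: cyclic_staircase_def\<close>)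
  then show ?thesis
    unfolding is_cyclic_staircase_def using n3 by blast
qed

text \<open>For \<open>k = 1\<close> the pair \<open>(x, y)\<close> is a whole component, so
  \<open>x\<close> is the only individual; but deletion demands one that lacks
  \<open>y\<close>.\<close>

lemma k_ge_2:
  assumes "x \<in> X" and "k > 0"
  shows "k \<ge> 2"
proof (rule ccontr)
  assume "\<not> k \<ge> 2"
  then have k: "k = 1" using assms by simp
  then obtain y where y: "R `` {x} = {y}"
    using card_row[OF assms(1)] card_1_singletonE by metis
  then have xy: "(x, y) \<in> R" by blast
  then have "card (R\<inverse> `` {y}) = 1" using card_col sub k by blast
  then obtain x' where "R\<inverse> `` {y} = {x'}" using card_1_singletonE by metis
  moreover have "x \<in> R\<inverse> `` {y}" using xy by simp
  ultimately have "R\<inverse> `` {y} = {x}" by simp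
  then have "a \<in> {x} \<longleftrightarrow> b \<in> {y}" if "(a, b) \<in> R" for a b
    using that y by blast
  from connected_rel_closed(1)[OF conn this assms(1)] have "X \<subseteq> {x}" by blast
  then show False using delete[OF xy] by blast
qed

end

section \<open>Constant degree and the case distinction on it\<close>

lemma isomorphic_rel_card:
  assumes "isomorphic_rel X Y R {1..n} {1..n} S"
  shows "card X = n" and "card Y = n"
  using assms unfolding isomorphic_rel_def by (auto dest: bij_betw_same_card)

theorem theorem74:
  fixes X :: "'a set" and Y :: "'b set" and R :: "('a \<times> 'b) set"
  assumes "relation_on X Y R"
    and "\<not> void X Y"
    and "connected_rel X Y R"
    and "tight X Y R"
    and "preserves_attribute_privacy X Y R"
    and "preserves_association_privacy X Y R"
  shows "card X = card Y \<and> card X \<ge> 3 \<and>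
    (is_cyclic_staircase X Y R \<or> is_spherical_boundary X Y R)"
proof -
  have sub: "R \<subseteq> X \<times> Y" and fin: "finite R"
    using assms(1) finite_subset[of R "X \<times> Y"] unfolding relation_on_def by auto
  have del: "\<exists>x'\<in>X. R `` {x} - R `` {x'} = {y}" if "(x, y) \<in> R" for x y
    using attribute_privacy_delete[OF sub assms(5) that] .
  have del': "\<exists>y'\<in>Y. R\<inverse> `` {y} - R\<inverse> `` {y'} = {x}" if "(y, x) \<in> R\<inverse>" for x y
    using attribute_privacy_delete[of "R\<inverse>" Y X y x] sub assms(6) that
    by (auto simp: preserves_attribute_privacy_converse)
  have eq: "card (R `` {x}) = card (R\<inverse> `` {y})" if xy: "(x, y) \<in> R" for x y
  proof (rule antisym)
    show "card (R `` {x}) \<le> card (R\<inverse> `` {y})"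
      using card_row_le_card_col[OF fin xy del] .
    have "card (R\<inverse> `` {y}) \<le> card ((R\<inverse>)\<inverse> `` {x})"
      by (rule card_row_le_card_col[OF _ _ del']) (use fin xy in auto)
    then show "card (R\<inverse> `` {y}) \<le> card (R `` {x})" by simp
  qed
  obtain x0 where x0: "x0 \<in> X" using assms(2) by (auto simp: void_def)
  define k where "k = card (R `` {x0})"
  \<comment> \<open>The two ends of an edge have the same degree, so the vertices of degree
    \<open>k\<close> form a union of components.\<close>
  have closed: "x \<in> {x. card (R `` {x}) = k} \<longleftrightarrow> y \<in> {y. card (R\<inverse> `` {y}) = k}"
    if "(x, y) \<in> R" for x y
    using eq[OF that] by simp
  have x0k: "x0 \<in> {x. card (R `` {x}) = k}" by (simp add: k_def)
  note reg = connected_rel_closed[OF assms(3) closed x0 x0k]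
  interpret private_regular X Y R k
    by unfold_locales (use fin sub assms(3) reg del in auto)
  have "R `` {x0} \<noteq> {}" using assms(4) x0 unfolding tight_def row_def by blast
  then have "k > 0" using finite_row by (simp add: k_def card_gt_0_iff)
  then have "k = 2 \<or> k \<ge> 3" using k_ge_2[OF x0] by linarith
  then have *: "is_cyclic_staircase X Y R \<or> is_spherical_boundary X Y R"
    using staircase spherical x0 by blast
  \<comment> \<open>\<open>S\<close> stands for either model; both live on \<open>{1..n}\<close> on
    each side, which yields the two cardinalities.\<close>
  then obtain n :: nat and S where "n \<ge> 3" "isomorphic_rel X Y R {1..n} {1..n} S"
    unfolding is_cyclic_staircase_def is_spherical_boundary_def by blast
  then show ?thesis using * isomorphic_rel_card[of X Y R n S] by simp
qed

end
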